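(* Let $\mathbb{F}_q$ be a finite field, let $W$ be a weighing matrix $\mathrm{W}(n,m)$, and let $G=[\,W\mid I_n\,]$ over $\mathbb{F}_q$. If $m+1=0$ in $\mathbb{F}_q$, then $G$ generates a self-dual code of length $2n$ and dimension $n$ over $\mathbb{F}_q$.
   Context: A weighing matrix $\mathrm{W}(n,m)$ is an $n\times n$ matrix $W$ with entries in $\{0,1,-1\}$ such that $WW^{\top}=mI_n$ over $\mathbb{C}$. Entries $0,\pm1$ and integers are interpreted in $\mathbb{F}_q$. A matrix over $\mathbb{F}_q$ generates the linear code spanned by its rows. For a linear code $C\subseteq\mathbb{F}_q^N$, $C^\perp$ is its orthogonal complement under the standard inner product, and $C$ is self-dual if $C=C^\perp$. *)

theory Defs
  imports Complex_Main "Jordan_Normal_Form.VS_Connect"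
begin

(* W is stored with integer entries so that the same matrix can be read over the complex
   numbers (for the defining equation) and over F_q (for the code), through of_int. *)
definition weighing_matrix :: "nat \<Rightarrow> nat \<Rightarrow> int mat \<Rightarrow> bool" where
  "weighing_matrix n m W \<longleftrightarrow>
     W \<in> carrier_mat n n \<and>
     (\<forall>i<n. \<forall>j<n. W $$ (i, j) \<in> {0, 1, -1}) \<and>
     map_mat of_int W * (map_mat of_int W)\<^sup>T = of_nat m \<cdot>\<^sub>m (1\<^sub>m n :: complex mat)"

(* [A | B]; the column analogue of append_rows. *)
definition append_cols :: "'a::zero mat \<Rightarrow> 'a mat \<Rightarrow> 'a mat" where
  "append_cols A B = four_block_mat A B (0\<^sub>m 0 (dim_col A)) (0\<^sub>m 0 (dim_col B))"

definition linear_code :: "nat \<Rightarrow> 'a::field vec set \<Rightarrow> bool" where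
  "linear_code N C \<longleftrightarrow> VectorSpace.subspace class_ring C (module_vec TYPE('a) N)"

definition generated_code :: "'a::field mat \<Rightarrow> 'a vec set" where
  "generated_code G = vec_space.row_space (dim_col G) G"

definition dual_code :: "nat \<Rightarrow> 'a::field vec set \<Rightarrow> 'a vec set" where
  "dual_code N C = vec_module.orthogonal_complement N C"

definition self_dual_code :: "nat \<Rightarrow> 'a::field vec set \<Rightarrow> bool" where
  "self_dual_code N C \<longleftrightarrow> linear_code N C \<and> C = dual_code N C"

definition code_dim :: "nat \<Rightarrow> 'a::field vec set \<Rightarrow> nat" where
  "code_dim N C = vectorspace.dim class_ring (module_vec TYPE('a) N\<lparr>carrier := C\<rparr>)"

end

(* The code generated by [A | I] is {(A^T y, y)}, and its dual is {(a, b). A a = -b}. If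
   A A^T = -I, then A is invertible with inverse -A^T, so A a = -b iff a = A^T b: the two codes
   coincide. The identity W W^T = m I holds over the integers and hence in every commutative
   ring, where m = -1 turns it into the hypothesis on A. *)
theory Submission
  imports Defs "Jordan_Normal_Form.DL_Rank"
begin

lemma append_cols_carrier:
  assumes "A \<in> carrier_mat nr nc1" "B \<in> carrier_mat nr nc2"
  shows "append_cols A B \<in> carrier_mat nr (nc1 + nc2)"
  using assms unfolding append_cols_def by auto

lemma transpose_append_cols:
  assumes "A \<in> carrier_mat nr nc1" "B \<in> carrier_mat nr nc2"
  shows "(append_cols A B)\<^sup>T = A\<^sup>T @\<^sub>r B\<^sup>T"
  using assms unfolding append_cols_def append_rows_def
  by (subst transpose_four_block_mat) auto

lemma row_append_cols:
  assumes "A \<in> carrier_mat nr nc1" "B \<in> carrier_mat nr nc2" "i < nr"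
  shows "row (append_cols A B) i = row A i @\<^sub>v row B i"
  using assms unfolding append_cols_def
  by (subst row_four_block_mat(1)[of _ nr nc1 _ nc2 _ 0]) auto

text \<open>Both sides of the complex identity are images of integer matrices, and
  \<open>of_int\<close> into the complex numbers is injective, so the identity already holds over
  the integers. Applying \<open>of_int\<close> entrywise then carries it to any commutative ring,
  whatever its characteristic.\<close>

lemma weighing_matrix_comm_ring:
  assumes "weighing_matrix n m W"
  shows "map_mat of_int W * (map_mat of_int W)\<^sup>T
    = of_nat m \<cdot>\<^sub>m (1\<^sub>m n :: 'a::comm_ring_1 mat)"
proof -
  have W: "W \<in> carrier_mat n n" and
    eq: "map_mat of_int W * (map_mat of_int W)\<^sup>T = of_nat m \<cdot>\<^sub>m (1\<^sub>m n :: complex mat)"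
    using assms unfolding weighing_matrix_def by auto
  \<comment> \<open>The ring \<open>'b\<close> is left free because this is used twice: over the
    complex numbers to descend to the integers, and over \<open>'a\<close> to leave them.\<close>
  have hom: "map_mat of_int W * (map_mat of_int W)\<^sup>T
      = (map_mat of_int (W * W\<^sup>T) :: 'b::comm_ring_1 mat)"
    unfolding of_int_hom.mat_hom_mult[OF W transpose_carrier_mat[THEN iffD2, OF W]] map_mat_transpose ..
  have "W * W\<^sup>T = int m \<cdot>\<^sub>m 1\<^sub>m n"
  proof (rule eq_matI)
    fix i j assume "i < dim_row (int m \<cdot>\<^sub>m 1\<^sub>m n)" "j < dim_col (int m \<cdot>\<^sub>m 1\<^sub>m n)"
    then have ij: "i < n" "j < n" by auto
    have "(of_int ((W * W\<^sup>T) $$ (i, j)) :: complex)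
        = (of_nat m \<cdot>\<^sub>m (1\<^sub>m n :: complex mat)) $$ (i, j)"
      unfolding eq[symmetric] hom using W ij by simp
    also have "\<dots> = of_int ((int m \<cdot>\<^sub>m 1\<^sub>m n) $$ (i, j))"
      using ij by simp
    finally show "(W * W\<^sup>T) $$ (i, j) = (int m \<cdot>\<^sub>m 1\<^sub>m n) $$ (i, j)"
      by (simp only: of_int_eq_iff)
  qed (use W in auto)
  then show ?thesis
    unfolding hom by (intro eq_matI) auto
qed

text \<open>The row space of a matrix is the range of its transpose, and here the transpose stacks
  \<open>A\<^sup>T\<close> on top of the identity.\<close>

lemma generated_code_systematic:
  fixes A :: "'a::field mat"
  assumes A: "A \<in> carrier_mat k n"
  shows "generated_code (append_cols A (1\<^sub>m k)) = {A\<^sup>T *\<^sub>v y @\<^sub>v y | y. y \<in> carrier_vec k}"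
proof -
  let ?G = "append_cols A (1\<^sub>m k)"
  have G: "?G \<in> carrier_mat k (n + k)"
    by (rule append_cols_carrier[OF A one_carrier_mat])
  have "?G\<^sup>T *\<^sub>v y = A\<^sup>T *\<^sub>v y @\<^sub>v y" if "y \<in> carrier_vec k" for y
    unfolding transpose_append_cols[OF A one_carrier_mat] transpose_one
    using mat_mult_append[OF transpose_carrier_mat[THEN iffD2, OF A] one_carrier_mat that] that by simp
  then show ?thesis
    unfolding generated_code_def carrier_matD[OF G] vec_space.row_space_eq[OF G]
    using A by (auto intro!: append_carrier_vec mult_mat_vec_carrier[of _ n k])
qed

text \<open>Pairing \<open>a @\<^sub>v b\<close> with row \<open>i\<close> of the generator gives
  entry \<open>i\<close> of \<open>A *\<^sub>v a\<close> plus entry \<open>i\<close> of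
  \<open>b\<close>; the dual code is where all these sums vanish.\<close>

lemma dual_code_systematic:
  fixes A :: "'a::field mat"
  assumes A: "A \<in> carrier_mat k n"
  shows "dual_code (n + k) (generated_code (append_cols A (1\<^sub>m k)))
    = {a @\<^sub>v b | a b. a \<in> carrier_vec n \<and> b \<in> carrier_vec k \<and> A *\<^sub>v a = - b}"
proof -
  interpret vec_space "TYPE('a)" "n + k" .
  let ?G = "append_cols A (1\<^sub>m k)"
  have G: "?G \<in> carrier_mat k (n + k)"
    by (rule append_cols_carrier[OF A one_carrier_mat])
  have rows: "set (rows ?G) \<subseteq> carrier_vec (n + k)"
    using rows_carrier[of ?G] G by auto
  \<comment> \<open>Orthogonality to a span need only be tested on the spanning vectors.\<close>
  have dual: "dual_code (n + k) (generated_code ?G) = orthogonal_complement (set (rows ?G))"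
    unfolding dual_code_def generated_code_def carrier_matD[OF G] row_space_def
    by (rule in_orthogonal_complement_span[OF rows])
  have iff: "(\<forall>r\<in>set (rows ?G). (a @\<^sub>v b) \<bullet> r = 0) \<longleftrightarrow> A *\<^sub>v a = - b"
    if a: "a \<in> carrier_vec n" and b: "b \<in> carrier_vec k" for a b
  proof -
    have "(a @\<^sub>v b) \<bullet> row ?G i = (A *\<^sub>v a) $ i + b $ i" if i: "i < k" for i
    proof -
      have "(a @\<^sub>v b) \<bullet> row ?G i = a \<bullet> row A i + b \<bullet> unit_vec k i"
        using a b i row_carrier_vec[of i k A n] A
        by (simp add: row_append_cols[OF A one_carrier_mat i] scalar_prod_append[of _ n _ k])
      also have "a \<bullet> row A i = row A i \<bullet> a"
        using a A i by (intro comm_scalar_prod[of _ n]) auto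
      finally show ?thesis
        using A b i by simp
    qed
    then have "(\<forall>r\<in>set (rows ?G). (a @\<^sub>v b) \<bullet> r = 0) \<longleftrightarrow> (\<forall>i<k. (A *\<^sub>v a) $ i + b $ i = 0)"
      using G by (auto simp: rows_def)
    also have "\<dots> \<longleftrightarrow> A *\<^sub>v a = - b"
      using A b by (auto simp: vec_eq_iff add_eq_0_iff2)
    finally show ?thesis .
  qed
  show ?thesis
    unfolding dual orthogonal_complement_def
  proof (intro equalityI subsetI)
    fix v assume "v \<in> {x \<in> carrier_vec (n + k). \<forall>r\<in>set (rows ?G). x \<bullet> r = 0}"
    then have v: "v \<in> carrier_vec (n + k)" and orth: "\<forall>r\<in>set (rows ?G). v \<bullet> r = 0" by auto
    have split: "v = vec_first v n @\<^sub>v vec_last v k"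
      using v by simp
    then have "A *\<^sub>v vec_first v n = - vec_last v k"
      using orth iff[of "vec_first v n" "vec_last v k"] by simp
    with split show "v \<in> {a @\<^sub>v b | a b. a \<in> carrier_vec n \<and> b \<in> carrier_vec k \<and> A *\<^sub>v a = - b}"
      by (metis (mono_tags, lifting) mem_Collect_eq vec_first_carrier vec_last_carrier)
  qed (use iff in auto)
qed

text \<open>The identity block makes \<open>y\<close> recoverable from the codeword it encodes, so
  the \<open>k\<close> rows of the generator are linearly independent.\<close>

lemma code_dim_systematic:
  fixes A :: "'a::field mat"
  assumes A: "A \<in> carrier_mat k n"
  shows "code_dim (n + k) (generated_code (append_cols A (1\<^sub>m k))) = k"
proof -
  interpret vec_space "TYPE('a)" "n + k" .
  let ?G = "append_cols A (1\<^sub>m k)"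
  have G: "?G \<in> carrier_mat k (n + k)"
    by (rule append_cols_carrier[OF A one_carrier_mat])
  have inj: "y = 0\<^sub>v k" if y: "y \<in> carrier_vec k" and "?G\<^sup>T *\<^sub>v y = 0\<^sub>v (n + k)" for y
  proof -
    have "A\<^sup>T *\<^sub>v y @\<^sub>v y = 0\<^sub>v n @\<^sub>v 0\<^sub>v k"
      using that A mat_mult_append[OF transpose_carrier_mat[THEN iffD2, OF A] one_carrier_mat y]
      unfolding transpose_append_cols[OF A one_carrier_mat] transpose_one by auto
    then show ?thesis
      using A y append_vec_eq[of "A\<^sup>T *\<^sub>v y" n] by simp
  qed
  \<comment> \<open>Independence is a property of the set of columns, which would hide repetitions,
    so distinctness of the list is established separately. Two rows of the generator already differ
    in their unit vector parts.\<close>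
  have distinct: "distinct (cols ?G\<^sup>T)"
    unfolding cols_transpose distinct_conv_nth
  proof (intro allI impI)
    fix i j assume "i < length (rows ?G)" "j < length (rows ?G)" and neq: "i \<noteq> j"
    then have ij: "i < k" "j < k" using G by auto
    then have "unit_vec k i \<noteq> (unit_vec k j :: 'a vec)"
      using neq by simp
    then show "rows ?G ! i \<noteq> rows ?G ! j"
      using G A ij row_carrier_vec[of i k A n] row_carrier_vec[of j k A n]
      by (simp add: row_append_cols[OF A one_carrier_mat] append_vec_eq[of _ n])
  qed
  have "lin_indpt (set (cols ?G\<^sup>T))"
    using lin_depE[OF transpose_carrier_mat[THEN iffD2, OF G] _ distinct] inj by metis
  then have "rank ?G\<^sup>T = k"
    by (rule lin_indpt_full_rank[OF transpose_carrier_mat[THEN iffD2, OF G] distinct])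
  then show ?thesis
    \<comment> \<open>\<open>rank\<close> is the dimension of the column span, and the columns of
      the transpose are the rows of the generator.\<close>
    unfolding code_dim_def generated_code_def rank_def carrier_matD[OF G] row_space_def
    by simp
qed

lemma linear_code_generated_code:
  "linear_code (dim_col G) (generated_code G)"
proof -
  interpret vec_space "TYPE('a)" "dim_col G" .
  show ?thesis
    unfolding linear_code_def generated_code_def row_space_def
    by (rule span_is_subspace) (simp add: rows_carrier)
qed

lemma self_dual_code_systematic:
  fixes A :: "'a::field mat"
  assumes A: "A \<in> carrier_mat n n" and AAt: "A * A\<^sup>T = - 1\<^sub>m n"
  shows "self_dual_code (n + n) (generated_code (append_cols A (1\<^sub>m n)))"
proof -
  let ?G = "append_cols A (1\<^sub>m n)"
  have At: "A\<^sup>T \<in> carrier_mat n n" using A by simp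
  have "A * (- A\<^sup>T) = 1\<^sub>m n"
    using A AAt by simp
  \<comment> \<open>For square matrices over a field a right inverse is also a left inverse.\<close>
  then have "(- A\<^sup>T) * A = 1\<^sub>m n"
    by (intro mat_mult_left_right_inverse[OF A]) (use At in simp)
  then have "- (A\<^sup>T * A) = 1\<^sub>m n" using A by simp
  then have AtA: "A\<^sup>T * A = - 1\<^sub>m n" by (metis uminus_uminus_mat)
  \<comment> \<open>The forward direction multiplies by \<open>A\<^sup>T\<close> and needs
    \<open>AtA\<close>; the converse needs only the hypothesis \<open>AAt\<close>.\<close>
  have solve: "A *\<^sub>v a = - b \<longleftrightarrow> a = A\<^sup>T *\<^sub>v b"
    if a: "a \<in> carrier_vec n" and b: "b \<in> carrier_vec n" for a b
  proof
    assume "A *\<^sub>v a = - b"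
    then have "A\<^sup>T *\<^sub>v (A *\<^sub>v a) = - (A\<^sup>T *\<^sub>v b)"
      using At b by (intro eq_vecI) auto
    moreover have "A\<^sup>T *\<^sub>v (A *\<^sub>v a) = - a"
      using assoc_mult_mat_vec[OF At A a] AtA a by simp
    ultimately show "a = A\<^sup>T *\<^sub>v b"
      by (metis uminus_uminus_vec)
  next
    assume "a = A\<^sup>T *\<^sub>v b"
    then show "A *\<^sub>v a = - b"
      using assoc_mult_mat_vec[OF A At b] AAt b by simp
  qed
  \<comment> \<open>By \<open>solve\<close>, the equation cutting out the dual code says exactly
    that its first half is \<open>A\<^sup>T\<close> applied to its second half.\<close>
  have "generated_code ?G = dual_code (n + n) (generated_code ?G)"
    unfolding dual_code_systematic[OF A] unfolding generated_code_systematic[OF A]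
    using solve mult_mat_vec_carrier[OF At] by blast
  moreover have "linear_code (n + n) (generated_code ?G)"
    using linear_code_generated_code[of ?G] append_cols_carrier[OF A one_carrier_mat] by simp
  ultimately show ?thesis
    unfolding self_dual_code_def by blast
qed

theorem mainTheorem3:
  fixes n m :: nat and W :: "int mat" and G :: "'q::{field, finite} mat"
  assumes W: "weighing_matrix n m W"
    and m: "of_nat m + 1 = (0::'q)"
  defines "G \<equiv> append_cols (map_mat of_int W) (1\<^sub>m n)"
  shows "self_dual_code (2 * n) (generated_code G) \<and> code_dim (2 * n) (generated_code G) = n"
proof -
  have A: "map_mat of_int W \<in> carrier_mat n n"
    using W unfolding weighing_matrix_def by simp
  have "of_nat m = (-1 :: 'q)"
    using m by (simp add: eq_neg_iff_add_eq_0)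
  then have "map_mat of_int W * (map_mat of_int W)\<^sup>T = (- 1\<^sub>m n :: 'q mat)"
    unfolding weighing_matrix_comm_ring[OF W] by (intro eq_matI) auto
  then show ?thesis
    unfolding G_def mult_2
    using self_dual_code_systematic[OF A] code_dim_systematic[OF A] by blast
qed

end
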